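(* Let $(\mathcal{C},\mathbb{E},\mathfrak{s})$ be an extriangulated category. Then the poset of cotorsion pairs in $\mathcal{C}$ is a lattice.
   Context: Extriangulated categories are in the sense of Nakaoka–Palu. A pair $(\mathcal{X},\mathcal{Y})$ of full subcategories of $\mathcal{C}$ is a cotorsion pair if: $\mathbb{E}(x,\mathcal{Y})=0$ if and only if $x\in\mathcal{X}$; and $\mathbb{E}(\mathcal{X},y)=0$ if and only if $y\in\mathcal{Y}$ (no completeness/approximation condition is required). Cotorsion pairs are ordered by $(\mathcal{X}_1,\mathcal{Y}_1)\preceq(\mathcal{X}_2,\mathcal{Y}_2)\iff\mathcal{X}_1\supseteq\mathcal{X}_2\iff\mathcal{Y}_1\subseteq\mathcal{Y}_2$. A lattice is a poset in which any two elements have a meet and a join. *)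

theory Defs
  imports "HOL-Algebra.Group" "HOL-Algebra.Lattice"
begin

section \<open>Additive categories\<close>

text \<open>
  A category is given by a set of objects, a set of morphisms, and \<open>g \<cdot> f\<close> for ``g after f''; only
  the values of the operations on composable or parallel morphisms are constrained.
  \<open>Add\<close> and \<open>Zero A B\<close> are the addition and the zero of the groups of morphisms.
\<close>

record ('o, 'm) additive_cat =
  Obj :: "'o set"
  Arr :: "'m set"
  Dom :: "'m \<Rightarrow> 'o"
  Cod :: "'m \<Rightarrow> 'o"
  Id :: "'o \<Rightarrow> 'm"
  Comp :: "'m \<Rightarrow> 'm \<Rightarrow> 'm" (infixr "\<cdot>\<index>" 70)
  Add :: "'m \<Rightarrow> 'm \<Rightarrow> 'm" (infixl "\<boxplus>\<index>" 65)
  Zero :: "'o \<Rightarrow> 'o \<Rightarrow> 'm"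

definition Hom :: "('o, 'm) additive_cat \<Rightarrow> 'o \<Rightarrow> 'o \<Rightarrow> 'm set" where
  "Hom C A B = {f \<in> Arr C. Dom C f = A \<and> Cod C f = B}"

definition Hom_group :: "('o, 'm) additive_cat \<Rightarrow> 'o \<Rightarrow> 'o \<Rightarrow> 'm monoid" where
  "Hom_group C A B = \<lparr>carrier = Hom C A B, mult = Add C, one = Zero C A B\<rparr>"

definition iso_mor :: "('o, 'm) additive_cat \<Rightarrow> 'o \<Rightarrow> 'o \<Rightarrow> 'm \<Rightarrow> bool" where
  "iso_mor C A B f \<longleftrightarrow> f \<in> Hom C A B \<and>
     (\<exists>g \<in> Hom C B A. Comp C g f = Id C A \<and> Comp C f g = Id C B)"

definition zero_object :: "('o, 'm) additive_cat \<Rightarrow> 'o \<Rightarrow> bool" where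
  "zero_object C Z \<longleftrightarrow> Z \<in> Obj C \<and>
     (\<forall>A \<in> Obj C. (\<exists>!f. f \<in> Hom C Z A) \<and> (\<exists>!f. f \<in> Hom C A Z))"

text \<open>\<open>P\<close> is a direct sum of \<open>A\<close> and \<open>B\<close> with inclusions \<open>i, j\<close> and projections \<open>p, q\<close>.\<close>

definition biproduct ::
  "('o, 'm) additive_cat \<Rightarrow> 'o \<Rightarrow> 'o \<Rightarrow> 'o \<Rightarrow> 'm \<Rightarrow> 'm \<Rightarrow> 'm \<Rightarrow> 'm \<Rightarrow> bool" where
  "biproduct C A B P i j p q \<longleftrightarrow>
     A \<in> Obj C \<and> B \<in> Obj C \<and> P \<in> Obj C \<and>
     i \<in> Hom C A P \<and> j \<in> Hom C B P \<and> p \<in> Hom C P A \<and> q \<in> Hom C P B \<and>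
     Comp C p i = Id C A \<and> Comp C q j = Id C B \<and>
     Comp C q i = Zero C A B \<and> Comp C p j = Zero C B A \<and>
     Add C (Comp C i p) (Comp C j q) = Id C P"

locale category =
  fixes C :: "('o, 'm) additive_cat" (structure)
  assumes Dom_in: "f \<in> Arr C \<Longrightarrow> Dom C f \<in> Obj C"
    and Cod_in: "f \<in> Arr C \<Longrightarrow> Cod C f \<in> Obj C"
    and Id_in: "A \<in> Obj C \<Longrightarrow> Id C A \<in> Hom C A A"
    and Comp_in: "\<lbrakk>f \<in> Hom C A B; g \<in> Hom C B D\<rbrakk> \<Longrightarrow> g \<cdot> f \<in> Hom C A D"
    and Id_left: "f \<in> Hom C A B \<Longrightarrow> Id C B \<cdot> f = f"
    and Id_right: "f \<in> Hom C A B \<Longrightarrow> f \<cdot> Id C A = f"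
    and Comp_assoc: "\<lbrakk>f \<in> Hom C A B; g \<in> Hom C B D; h \<in> Hom C D F\<rbrakk> \<Longrightarrow> (h \<cdot> g) \<cdot> f = h \<cdot> (g \<cdot> f)"

locale preadditive_category = category +
  assumes Hom_comm_group: "\<lbrakk>A \<in> Obj C; B \<in> Obj C\<rbrakk> \<Longrightarrow> comm_group (Hom_group C A B)"
    and Comp_Add_left:
      "\<lbrakk>f \<in> Hom C A B; g \<in> Hom C B D; g' \<in> Hom C B D\<rbrakk> \<Longrightarrow> (g \<boxplus> g') \<cdot> f = (g \<cdot> f) \<boxplus> (g' \<cdot> f)"
    and Comp_Add_right:
      "\<lbrakk>f \<in> Hom C A B; f' \<in> Hom C A B; g \<in> Hom C B D\<rbrakk> \<Longrightarrow> g \<cdot> (f \<boxplus> f') = (g \<cdot> f) \<boxplus> (g \<cdot> f')"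

locale additive_category = preadditive_category +
  assumes ex_zero_object: "\<exists>Z. zero_object C Z"
    and ex_biproduct: "\<lbrakk>A \<in> Obj C; B \<in> Obj C\<rbrakk> \<Longrightarrow> \<exists>P i j p q. biproduct C A B P i j p q"


section \<open>Biadditive functors and extensions\<close>

text \<open>
  \<open>Eob E X A\<close> is the abelian group \<open>\<bbbE>(X, A)\<close> (contravariant in \<open>X\<close>, covariant in \<open>A\<close>); following
  HOL-Algebra its operation is written multiplicatively, so \<open>\<one>\<close> is the split extension \<open>0\<close>.
  \<open>Emor E c a\<close> is \<open>\<bbbE>(c, a)\<close>.
\<close>

record ('o, 'm, 'e) bifunctor =
  Eob :: "'o \<Rightarrow> 'o \<Rightarrow> 'e monoid"
  Emor :: "'m \<Rightarrow> 'm \<Rightarrow> 'e \<Rightarrow> 'e"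

locale biadditive_functor = additive_category +
  fixes E :: "('o, 'm, 'e) bifunctor"
  assumes Eob_comm_group: "\<lbrakk>X \<in> Obj C; A \<in> Obj C\<rbrakk> \<Longrightarrow> comm_group (Eob E X A)"
    and Emor_hom:
      "\<lbrakk>c \<in> Hom C X' X; a \<in> Hom C A A'\<rbrakk> \<Longrightarrow> Emor E c a \<in> hom (Eob E X A) (Eob E X' A')"
    and Emor_Id:
      "\<lbrakk>X \<in> Obj C; A \<in> Obj C; \<delta> \<in> carrier (Eob E X A)\<rbrakk> \<Longrightarrow> Emor E (Id C X) (Id C A) \<delta> = \<delta>"
    and Emor_Comp:
      "\<lbrakk>c \<in> Hom C X' X; c' \<in> Hom C X'' X'; a \<in> Hom C A A'; a' \<in> Hom C A' A'';
        \<delta> \<in> carrier (Eob E X A)\<rbrakk>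
       \<Longrightarrow> Emor E (c \<cdot> c') (a' \<cdot> a) \<delta> = Emor E c' a' (Emor E c a \<delta>)"
    and Emor_Add_left:
      "\<lbrakk>c \<in> Hom C X' X; c' \<in> Hom C X' X; a \<in> Hom C A A'; \<delta> \<in> carrier (Eob E X A)\<rbrakk>
       \<Longrightarrow> Emor E (c \<boxplus> c') a \<delta> = Emor E c a \<delta> \<otimes>\<^bsub>Eob E X' A'\<^esub> Emor E c' a \<delta>"
    and Emor_Add_right:
      "\<lbrakk>c \<in> Hom C X' X; a \<in> Hom C A A'; a' \<in> Hom C A A'; \<delta> \<in> carrier (Eob E X A)\<rbrakk>
       \<Longrightarrow> Emor E c (a \<boxplus> a') \<delta> = Emor E c a \<delta> \<otimes>\<^bsub>Eob E X' A'\<^esub> Emor E c a' \<delta>"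

text \<open>\<open>is_extension C E A \<delta> X\<close>: the triple \<open>(A, \<delta>, X)\<close> is an \<open>\<bbbE>\<close>-extension, i.e. \<open>\<delta> \<in> \<bbbE>(X, A)\<close>.\<close>

definition is_extension ::
  "('o, 'm) additive_cat \<Rightarrow> ('o, 'm, 'e) bifunctor \<Rightarrow> 'o \<Rightarrow> 'e \<Rightarrow> 'o \<Rightarrow> bool" where
  "is_extension C E A \<delta> X \<longleftrightarrow> A \<in> Obj C \<and> X \<in> Obj C \<and> \<delta> \<in> carrier (Eob E X A)"

text \<open>For \<open>\<delta> \<in> \<bbbE>(X, A)\<close>: \<open>push C E X a \<delta> = a\<^sub>* \<delta>\<close> and \<open>pull C E A c \<delta> = c\<^sup>* \<delta>\<close>.\<close>

definition push ::
  "('o, 'm) additive_cat \<Rightarrow> ('o, 'm, 'e) bifunctor \<Rightarrow> 'o \<Rightarrow> 'm \<Rightarrow> 'e \<Rightarrow> 'e" where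
  "push C E X a = Emor E (Id C X) a"

definition pull ::
  "('o, 'm) additive_cat \<Rightarrow> ('o, 'm, 'e) bifunctor \<Rightarrow> 'o \<Rightarrow> 'm \<Rightarrow> 'e \<Rightarrow> 'e" where
  "pull C E A c = Emor E c (Id C A)"

text \<open>\<open>(a, c)\<close> is a morphism of extensions \<open>(A, \<delta>, X) \<rightarrow> (A', \<delta>', X')\<close>.\<close>

definition extension_mor ::
  "('o, 'm) additive_cat \<Rightarrow> ('o, 'm, 'e) bifunctor \<Rightarrow>
   'o \<Rightarrow> 'e \<Rightarrow> 'o \<Rightarrow> 'o \<Rightarrow> 'e \<Rightarrow> 'o \<Rightarrow> 'm \<Rightarrow> 'm \<Rightarrow> bool" where
  "extension_mor C E A \<delta> X A' \<delta>' X' a c \<longleftrightarrow>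
     is_extension C E A \<delta> X \<and> is_extension C E A' \<delta>' X' \<and>
     a \<in> Hom C A A' \<and> c \<in> Hom C X X' \<and> push C E X a \<delta> = pull C E A' c \<delta>'"

text \<open>
  \<open>\<theta> \<in> \<bbbE>(R, P)\<close> is \<open>\<delta> \<oplus> \<delta>'\<close>, where \<open>P = A \<oplus> A'\<close> has projections \<open>p, p'\<close> and \<open>R = X \<oplus> X'\<close> has
  inclusions \<open>i, i'\<close>: it corresponds to \<open>(\<delta>, 0, 0, \<delta>')\<close> under
  \<open>\<bbbE>(X \<oplus> X', A \<oplus> A') \<cong> \<bbbE>(X, A) \<oplus> \<bbbE>(X, A') \<oplus> \<bbbE>(X', A) \<oplus> \<bbbE>(X', A')\<close>.
\<close>

definition is_extension_sum ::
  "('o, 'm, 'e) bifunctor \<Rightarrow> 'o \<Rightarrow> 'e \<Rightarrow> 'o \<Rightarrow> 'o \<Rightarrow> 'e \<Rightarrow> 'o \<Rightarrow>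
   'o \<Rightarrow> 'm \<Rightarrow> 'm \<Rightarrow> 'o \<Rightarrow> 'm \<Rightarrow> 'm \<Rightarrow> 'e \<Rightarrow> bool" where
  "is_extension_sum E A \<delta> X A' \<delta>' X' P p p' R i i' \<theta> \<longleftrightarrow>
     \<theta> \<in> carrier (Eob E R P) \<and>
     Emor E i p \<theta> = \<delta> \<and> Emor E i p' \<theta> = \<one>\<^bsub>Eob E X A'\<^esub> \<and>
     Emor E i' p \<theta> = \<one>\<^bsub>Eob E X' A\<^esub> \<and> Emor E i' p' \<theta> = \<delta>'"


section \<open>Realizations\<close>

text \<open>
  The pair \<open>(x, y)\<close> stands for the sequence of morphisms \<open>A \<rightarrow> B \<rightarrow> X\<close> given by \<open>x\<close> and \<open>y\<close>; no
  condition is imposed on \<open>y \<cdot> x\<close>.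
\<close>

definition seqs :: "('o, 'm) additive_cat \<Rightarrow> 'o \<Rightarrow> 'o \<Rightarrow> ('m \<times> 'm) set" where
  "seqs C A X = {(x, y). \<exists>B \<in> Obj C. x \<in> Hom C A B \<and> y \<in> Hom C B X}"

definition seq_equiv :: "('o, 'm) additive_cat \<Rightarrow> 'o \<Rightarrow> 'o \<Rightarrow> (('m \<times> 'm) \<times> ('m \<times> 'm)) set" where
  "seq_equiv C A X = {((x, y), (x', y')). (x, y) \<in> seqs C A X \<and> (x', y') \<in> seqs C A X \<and>
     (\<exists>b. iso_mor C (Cod C x) (Cod C x') b \<and> Comp C b x = x' \<and> Comp C y' b = y)}"

definition seq_class :: "('o, 'm) additive_cat \<Rightarrow> 'o \<Rightarrow> 'o \<Rightarrow> 'm \<Rightarrow> 'm \<Rightarrow> ('m \<times> 'm) set" where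
  "seq_class C A X x y = seq_equiv C A X `` {(x, y)}"

text \<open>
  A correspondence \<open>\<ss>\<close> assigns to \<open>\<delta> \<in> \<bbbE>(X, A)\<close> an equivalence class \<open>s X A \<delta>\<close> of sequences.
  \<open>realized_by C E s A \<delta> X x B y\<close> says that \<open>\<ss>(\<delta>)\<close> is the class of \<open>A \<rightarrow> B \<rightarrow> X\<close>.
\<close>

definition realized_by ::
  "('o, 'm) additive_cat \<Rightarrow> ('o, 'm, 'e) bifunctor \<Rightarrow> ('o \<Rightarrow> 'o \<Rightarrow> 'e \<Rightarrow> ('m \<times> 'm) set) \<Rightarrow>
   'o \<Rightarrow> 'e \<Rightarrow> 'o \<Rightarrow> 'm \<Rightarrow> 'o \<Rightarrow> 'm \<Rightarrow> bool" where
  "realized_by C E s A \<delta> X x B y \<longleftrightarrow>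
     is_extension C E A \<delta> X \<and> x \<in> Hom C A B \<and> y \<in> Hom C B X \<and>
     s X A \<delta> = seq_class C A X x y"

locale realization = biadditive_functor +
  fixes s :: "'o \<Rightarrow> 'o \<Rightarrow> 'e \<Rightarrow> ('m \<times> 'm) set"
  assumes s_class: "is_extension C E A \<delta> X \<Longrightarrow> s X A \<delta> \<in> seqs C A X // seq_equiv C A X"
    and realize_mor:
      "\<lbrakk>realized_by C E s A \<delta> X x B y; realized_by C E s A' \<delta>' X' x' B' y';
        extension_mor C E A \<delta> X A' \<delta>' X' a c\<rbrakk>
       \<Longrightarrow> \<exists>b \<in> Hom C B B'. b \<cdot> x = x' \<cdot> a \<and> y' \<cdot> b = c \<cdot> y"

text \<open>
  Direct sums are only determined up to isomorphism, so additivity of the realization is required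
  for every choice of the direct sums involved. In \<open>s_sum\<close>, \<open>P\<close>, \<open>Q\<close> and \<open>R\<close> are
  \<open>A \<oplus> A'\<close>, \<open>B \<oplus> B'\<close> and \<open>X \<oplus> X'\<close>, and the two morphisms in the conclusion are \<open>x \<oplus> x'\<close> and
  \<open>y \<oplus> y'\<close>.
\<close>

locale additive_realization = realization +
  assumes s_zero:
      "biproduct C A X B i j p q \<Longrightarrow> realized_by C E s A \<one>\<^bsub>Eob E X A\<^esub> X i B q"
    and s_sum:
      "\<lbrakk>realized_by C E s A \<delta> X x B y; realized_by C E s A' \<delta>' X' x' B' y';
        biproduct C A A' P iA iA' pA pA'; biproduct C B B' Q iB iB' pB pB';
        biproduct C X X' R iX iX' pX pX';
        is_extension_sum E A \<delta> X A' \<delta>' X' P pA pA' R iX iX' \<theta>\<rbrakk>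
       \<Longrightarrow> realized_by C E s P \<theta> R
             ((iB \<cdot> x \<cdot> pA) \<boxplus> (iB' \<cdot> x' \<cdot> pA')) Q ((iX \<cdot> y \<cdot> pB) \<boxplus> (iX' \<cdot> y' \<cdot> pB'))"


section \<open>Extriangulated categories\<close>

text \<open>
  The axioms of Nakaoka and Palu; (ET1) and (ET2) are inherited from \<open>biadditive_functor\<close> and
  \<open>additive_realization\<close>.
\<close>

locale extriangulated_category = additive_realization +
  assumes ET3:
      "\<lbrakk>realized_by C E s A \<delta> X x B y; realized_by C E s A' \<delta>' X' x' B' y';
        a \<in> Hom C A A'; b \<in> Hom C B B'; b \<cdot> x = x' \<cdot> a\<rbrakk>
       \<Longrightarrow> \<exists>c. extension_mor C E A \<delta> X A' \<delta>' X' a c \<and> c \<cdot> y = y' \<cdot> b"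
    and ET3_op:
      "\<lbrakk>realized_by C E s A \<delta> X x B y; realized_by C E s A' \<delta>' X' x' B' y';
        b \<in> Hom C B B'; c \<in> Hom C X X'; c \<cdot> y = y' \<cdot> b\<rbrakk>
       \<Longrightarrow> \<exists>a. extension_mor C E A \<delta> X A' \<delta>' X' a c \<and> b \<cdot> x = x' \<cdot> a"
    and ET4:
      "\<lbrakk>realized_by C E s A \<delta> D f B f'; realized_by C E s B \<delta>' F g G g'\<rbrakk>
       \<Longrightarrow> \<exists>H h h' d e \<delta>''.
             d \<in> Hom C D H \<and> e \<in> Hom C H F \<and>
             realized_by C E s A \<delta>'' H h G h' \<and>
             g \<cdot> f = h \<and> h' \<cdot> g = d \<cdot> f' \<and> e \<cdot> h' = g' \<and>
             realized_by C E s D (push C E F f' \<delta>') F d H e \<and>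
             pull C E A d \<delta>'' = \<delta> \<and>
             push C E H f \<delta>'' = pull C E B e \<delta>'"
    and ET4_op:
      "\<lbrakk>realized_by C E s D \<delta> B f' A f; realized_by C E s F \<delta>' G g' B g\<rbrakk>
       \<Longrightarrow> \<exists>H h h' d e \<delta>''.
             d \<in> Hom C D H \<and> e \<in> Hom C H F \<and>
             realized_by C E s H \<delta>'' G h' A h \<and>
             h' \<cdot> d = f' \<and> f \<cdot> h' = g' \<cdot> e \<and> g \<cdot> f = h \<and>
             realized_by C E s D (pull C E D g' \<delta>) F d H e \<and>
             \<delta>' = push C E G e \<delta>'' \<and>
             push C E B d \<delta> = pull C E H g \<delta>''"


section \<open>Cotorsion pairs\<close>

text \<open>
  A full subcategory is given by its set of objects. The defining equivalences make both members of
  a cotorsion pair closed under isomorphisms.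
\<close>

definition E_vanishes :: "('o, 'm, 'e) bifunctor \<Rightarrow> 'o \<Rightarrow> 'o \<Rightarrow> bool" where
  "E_vanishes E X A \<longleftrightarrow> carrier (Eob E X A) = {\<one>\<^bsub>Eob E X A\<^esub>}"

definition cotorsion_pair ::
  "('o, 'm) additive_cat \<Rightarrow> ('o, 'm, 'e) bifunctor \<Rightarrow> 'o set \<Rightarrow> 'o set \<Rightarrow> bool" where
  "cotorsion_pair C E \<X> \<Y> \<longleftrightarrow>
     \<X> \<subseteq> Obj C \<and> \<Y> \<subseteq> Obj C \<and>
     (\<forall>x \<in> Obj C. (\<forall>y \<in> \<Y>. E_vanishes E x y) \<longleftrightarrow> x \<in> \<X>) \<and>
     (\<forall>y \<in> Obj C. (\<forall>x \<in> \<X>. E_vanishes E x y) \<longleftrightarrow> y \<in> \<Y>)"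

definition cotorsion_poset ::
  "('o, 'm) additive_cat \<Rightarrow> ('o, 'm, 'e) bifunctor \<Rightarrow> ('o set \<times> 'o set) gorder" where
  "cotorsion_poset C E =
     \<lparr>carrier = {(\<X>, \<Y>). cotorsion_pair C E \<X> \<Y>}, eq = (=),
      le = (\<lambda>(\<X>\<^sub>1, \<Y>\<^sub>1) (\<X>\<^sub>2, \<Y>\<^sub>2). \<X>\<^sub>2 \<subseteq> \<X>\<^sub>1)\<rparr>"

lemma cotorsion_pair_order_iff:
  assumes "cotorsion_pair C E \<X>\<^sub>1 \<Y>\<^sub>1" and "cotorsion_pair C E \<X>\<^sub>2 \<Y>\<^sub>2"
  shows "\<X>\<^sub>2 \<subseteq> \<X>\<^sub>1 \<longleftrightarrow> \<Y>\<^sub>1 \<subseteq> \<Y>\<^sub>2"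
  using assms unfolding cotorsion_pair_def by (meson subset_iff)

end

(* E-vanishing is a relation between objects, and cotorsion pairs are the closed pairs of the
   Galois connection (the two orthogonals) that it induces. Hence the intersection of two left halves
   is again a left half, which gives joins, and dually the intersection of two right halves gives
   meets. *)

theory Submission
  imports Defs
begin

text \<open>Restricting to \<open>Obj C\<close> builds the two inclusions into \<open>Obj C\<close>
  required of a cotorsion pair into the orthogonals themselves.\<close>

definition left_orth ::
  "('o, 'm) additive_cat \<Rightarrow> ('o, 'm, 'e) bifunctor \<Rightarrow> 'o set \<Rightarrow> 'o set" where
  "left_orth C E \<Y> = {x \<in> Obj C. \<forall>y \<in> \<Y>. E_vanishes E x y}"

definition right_orth ::
  "('o, 'm) additive_cat \<Rightarrow> ('o, 'm, 'e) bifunctor \<Rightarrow> 'o set \<Rightarrow> 'o set" where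
  "right_orth C E \<X> = {y \<in> Obj C. \<forall>x \<in> \<X>. E_vanishes E x y}"

lemma cotorsion_pair_iff_orth:
  "cotorsion_pair C E \<X> \<Y> \<longleftrightarrow> \<X> = left_orth C E \<Y> \<and> \<Y> = right_orth C E \<X>"
  unfolding cotorsion_pair_def left_orth_def right_orth_def set_eq_iff mem_Collect_eq subset_iff
  by meson

lemma left_orth_antimono: "\<Y> \<subseteq> \<Y>' \<Longrightarrow> left_orth C E \<Y>' \<subseteq> left_orth C E \<Y>"
  by (auto simp: left_orth_def)

lemma right_orth_antimono: "\<X> \<subseteq> \<X>' \<Longrightarrow> right_orth C E \<X>' \<subseteq> right_orth C E \<X>"
  by (auto simp: right_orth_def)

lemma subset_left_right_orth: "\<X> \<subseteq> Obj C \<Longrightarrow> \<X> \<subseteq> left_orth C E (right_orth C E \<X>)"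
  by (auto simp: left_orth_def right_orth_def)

lemma subset_right_left_orth: "\<Y> \<subseteq> Obj C \<Longrightarrow> \<Y> \<subseteq> right_orth C E (left_orth C E \<Y>)"
  by (auto simp: left_orth_def right_orth_def)

text \<open>Taking the right and then the left orthogonal is a closure operator on sets of objects,
  and its closed sets are the left halves; closed sets are stable under intersection. The right half
  has to be computed as an orthogonal, since the union of the two given right halves need not be
  closed.\<close>

lemma cotorsion_pair_Int_left:
  assumes "cotorsion_pair C E \<X>\<^sub>1 \<Y>\<^sub>1" and "cotorsion_pair C E \<X>\<^sub>2 \<Y>\<^sub>2"
  shows "cotorsion_pair C E (\<X>\<^sub>1 \<inter> \<X>\<^sub>2) (right_orth C E (\<X>\<^sub>1 \<inter> \<X>\<^sub>2))"
proof -
  have closed: "left_orth C E (right_orth C E (\<X>\<^sub>1 \<inter> \<X>\<^sub>2)) \<subseteq> \<X>"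
    if "cotorsion_pair C E \<X> \<Y>" and "\<X>\<^sub>1 \<inter> \<X>\<^sub>2 \<subseteq> \<X>" for \<X> \<Y>
  proof -
    have "\<X> = left_orth C E (right_orth C E \<X>)"
      using that(1) unfolding cotorsion_pair_iff_orth by metis
    with left_orth_antimono[OF right_orth_antimono[OF that(2)]] show ?thesis
      by metis
  qed
  have "\<X>\<^sub>1 \<inter> \<X>\<^sub>2 \<subseteq> Obj C"
    using assms(1) unfolding cotorsion_pair_def by (meson le_infI1)
  \<comment> \<open>\<open>closed\<close> enters once for each given pair. The unfolding below is
    instantiated so that it rewrites only the goal and leaves \<open>assms\<close> in the form that
    \<open>closed\<close> expects.\<close>
  from equalityI[OF subset_left_right_orth[OF this] Int_greatest[OF closed closed]] assms
  show ?thesis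
    unfolding cotorsion_pair_iff_orth[of _ _ "\<X>\<^sub>1 \<inter> \<X>\<^sub>2"] by (meson Int_lower1 Int_lower2)
qed

text \<open>Mirror image: the orthogonals composed in the other order also form a closure operator,
  whose closed sets are the right halves.\<close>

lemma cotorsion_pair_Int_right:
  assumes "cotorsion_pair C E \<X>\<^sub>1 \<Y>\<^sub>1" and "cotorsion_pair C E \<X>\<^sub>2 \<Y>\<^sub>2"
  shows "cotorsion_pair C E (left_orth C E (\<Y>\<^sub>1 \<inter> \<Y>\<^sub>2)) (\<Y>\<^sub>1 \<inter> \<Y>\<^sub>2)"
proof -
  have closed: "right_orth C E (left_orth C E (\<Y>\<^sub>1 \<inter> \<Y>\<^sub>2)) \<subseteq> \<Y>"
    if "cotorsion_pair C E \<X> \<Y>" and "\<Y>\<^sub>1 \<inter> \<Y>\<^sub>2 \<subseteq> \<Y>" for \<X> \<Y>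
  proof -
    have "\<Y> = right_orth C E (left_orth C E \<Y>)"
      using that(1) unfolding cotorsion_pair_iff_orth by metis
    with right_orth_antimono[OF left_orth_antimono[OF that(2)]] show ?thesis
      by metis
  qed
  have "\<Y>\<^sub>1 \<inter> \<Y>\<^sub>2 \<subseteq> Obj C"
    using assms(1) unfolding cotorsion_pair_def by (meson le_infI1)
  from equalityI[OF subset_right_left_orth[OF this] Int_greatest[OF closed closed]] assms
  show ?thesis
    unfolding cotorsion_pair_iff_orth[of _ _ _ "\<Y>\<^sub>1 \<inter> \<Y>\<^sub>2"] by (meson Int_lower1 Int_lower2)
qed

lemma carrier_cotorsion_poset:
  "(\<X>, \<Y>) \<in> carrier (cotorsion_poset C E) \<longleftrightarrow> cotorsion_pair C E \<X> \<Y>"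
  by (simp add: cotorsion_poset_def)

lemma le_cotorsion_poset:
  "(\<X>\<^sub>1, \<Y>\<^sub>1) \<sqsubseteq>\<^bsub>cotorsion_poset C E\<^esub> (\<X>\<^sub>2, \<Y>\<^sub>2) \<longleftrightarrow> \<X>\<^sub>2 \<subseteq> \<X>\<^sub>1"
  by (simp add: cotorsion_poset_def)

text \<open>Only antisymmetry needs an argument: the order compares left halves alone, but these
  determine the right halves.\<close>

lemma cotorsion_poset_partial_order: "partial_order (cotorsion_poset C E)"
  by standard (auto simp: cotorsion_poset_def dest: cotorsion_pair_order_iff)

text \<open>The order reverses inclusion of left halves, so the upper bounds are the cotorsion pairs
  whose left half lies in both \<open>\<X>\<^sub>1\<close> and \<open>\<X>\<^sub>2\<close>.\<close>

lemma cotorsion_poset_lub: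
  assumes "cotorsion_pair C E \<X>\<^sub>1 \<Y>\<^sub>1" and "cotorsion_pair C E \<X>\<^sub>2 \<Y>\<^sub>2"
  shows "least (cotorsion_poset C E) (\<X>\<^sub>1 \<inter> \<X>\<^sub>2, right_orth C E (\<X>\<^sub>1 \<inter> \<X>\<^sub>2))
           (Upper (cotorsion_poset C E) {(\<X>\<^sub>1, \<Y>\<^sub>1), (\<X>\<^sub>2, \<Y>\<^sub>2)})"
  using assms cotorsion_pair_Int_left[OF assms]
  by (auto simp: least_def Upper_def carrier_cotorsion_poset le_cotorsion_poset)

text \<open>Read through right halves, the order is plain inclusion, so the lower bounds are the
  cotorsion pairs whose right half lies in both \<open>\<Y>\<^sub>1\<close> and
  \<open>\<Y>\<^sub>2\<close>.\<close>

lemma cotorsion_poset_glb: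
  assumes "cotorsion_pair C E \<X>\<^sub>1 \<Y>\<^sub>1" and "cotorsion_pair C E \<X>\<^sub>2 \<Y>\<^sub>2"
  shows "greatest (cotorsion_poset C E) (left_orth C E (\<Y>\<^sub>1 \<inter> \<Y>\<^sub>2), \<Y>\<^sub>1 \<inter> \<Y>\<^sub>2)
           (Lower (cotorsion_poset C E) {(\<X>\<^sub>1, \<Y>\<^sub>1), (\<X>\<^sub>2, \<Y>\<^sub>2)})"
  using assms cotorsion_pair_Int_right[OF assms]
  by (auto simp: greatest_def Lower_def carrier_cotorsion_poset le_cotorsion_poset
      cotorsion_pair_order_iff)

lemma cotorsion_poset_lattice: "lattice (cotorsion_poset C E)"
proof -
  \<comment> \<open>With the order axioms in place, only the existence of binary suprema and infima
    is left to show.\<close>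
  interpret partial_order "cotorsion_poset C E"
    by (rule cotorsion_poset_partial_order)
  show ?thesis
  proof
    fix p q
    assume "p \<in> carrier (cotorsion_poset C E)" "q \<in> carrier (cotorsion_poset C E)"
    then obtain \<X>\<^sub>1 \<Y>\<^sub>1 \<X>\<^sub>2 \<Y>\<^sub>2 where pq: "p = (\<X>\<^sub>1, \<Y>\<^sub>1)" "q = (\<X>\<^sub>2, \<Y>\<^sub>2)"
      "cotorsion_pair C E \<X>\<^sub>1 \<Y>\<^sub>1" "cotorsion_pair C E \<X>\<^sub>2 \<Y>\<^sub>2"
      by (cases p, cases q) (simp add: carrier_cotorsion_poset)
    show "\<exists>u. least (cotorsion_poset C E) u (Upper (cotorsion_poset C E) {p, q})"
      unfolding pq(1,2) using cotorsion_poset_lub[OF pq(3,4)] by blast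
    show "\<exists>l. greatest (cotorsion_poset C E) l (Lower (cotorsion_poset C E) {p, q})"
      unfolding pq(1,2) using cotorsion_poset_glb[OF pq(3,4)] by blast
  qed
qed

theorem theorem4p11:
  fixes C :: "('o, 'm) additive_cat"
    and E :: "('o, 'm, 'e) bifunctor"
    and s :: "'o \<Rightarrow> 'o \<Rightarrow> 'e \<Rightarrow> ('m \<times> 'm) set"
  assumes "extriangulated_category C E s"
  shows "lattice (cotorsion_poset C E)"
  by (rule cotorsion_poset_lattice)

end
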